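(* Let $\varphi:[0,\infty)\to\mathbb{R}$ be a continuous function with \[ \int_0^{\infty}|\varphi(t)|\, dt<\infty . \] If the function $f:(0,\infty)\to\mathbb{R}$, $f(x)=\int_0^{\infty}\varphi(t)\, e^{-xt}\, dt$, is completely monotonic, then $\varphi(t)\ge 0$ for all $t\in[0,\infty)$.
   Context: An infinitely differentiable function $f:(0,\infty)\to\mathbb{R}$ is called completely monotonic if $(-1)^n f^{(n)}(x)\ge 0$ for all $x>0$ and all $n=0,1,2,\dots$ (where $f^{(0)}=f$). *)

theory Defs
  imports "HOL-Analysis.Analysis"
begin

(* A function on the open half-line is represented by a total function; only its values on
   {0<..} matter, since at a point of this open set all iterated derivatives depend only on the
   values nearby. The first conjunct is infinite differentiability; it is needed because deriv
   is an unspecified value where no derivative exists. *)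
definition completely_monotonic :: "(real \<Rightarrow> real) \<Rightarrow> bool" where
  "completely_monotonic f \<longleftrightarrow>
     (\<forall>n. \<forall>x>0. (deriv ^^ n) f field_differentiable (at x)) \<and>
     (\<forall>n. \<forall>x>0. (- 1) ^ n * (deriv ^^ n) f x \<ge> 0)"

end

theory Submission
  imports Defs
begin

text \<open>
  Differentiating under the integral sign turns complete monotonicity into nonnegativity of
  all integrals of \<open>t\<^sup>n \<phi>(t) e\<^sup>-\<^sup>x\<^sup>t\<close>. For \<open>x = n / s\<close> the weight is, up to a constant,
  the \<open>n\<close>-th power of \<open>(t / s) exp (1 - t / s)\<close>, which has its strict maximum \<open>1\<close> at \<open>t = s\<close>.
  If \<open>\<phi> s < 0\<close>, the contribution near \<open>s\<close> therefore dominates for large \<open>n\<close> and makes the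
  integral negative.
\<close>

section \<open>Exponential estimates and a criterion for differentiability\<close>

lemma power_mult_exp_neg_le:
  fixes a t :: real
  assumes "a > 0" "t \<ge> 0"
  shows "t ^ m * exp (- (a * t)) \<le> fact m / a ^ m"
proof -
  \<comment> \<open>A single term of the exponential series is at most the partial sum, and the
    Taylor remainder is nonnegative because \<open>a * t \<ge> 0\<close>.\<close>
  have "(a * t) ^ m / fact m \<le> (\<Sum>k<Suc m. (a * t) ^ k / fact k)"
    using assms by (intro member_le_sum) auto
  also have "\<dots> \<le> exp (a * t)"
  proof -
    obtain u where "exp (a * t) = (\<Sum>k<Suc m. (a * t) ^ k / fact k)
        + exp u / fact (Suc m) * (a * t) ^ Suc m"
      using Maclaurin_exp_le by blast
    moreover have "0 \<le> exp u / fact (Suc m) * (a * t) ^ Suc m"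
      using assms by (intro mult_nonneg_nonneg divide_nonneg_nonneg zero_le_power) auto
    ultimately show ?thesis by linarith
  qed
  finally show ?thesis
    using assms by (simp add: field_simps exp_minus)
qed

lemma abs_exp_minus_linear_le:
  fixes u :: real
  shows "\<bar>exp u - 1 - u\<bar> \<le> u\<^sup>2 * exp \<bar>u\<bar>"
proof -
  obtain v where v: "\<bar>v\<bar> \<le> \<bar>u\<bar>" "exp u = (\<Sum>m<2. u ^ m / fact m) + exp v / fact 2 * u ^ 2"
    using Maclaurin_exp_le by blast
  have "\<bar>exp u - 1 - u\<bar> = exp v / 2 * u\<^sup>2"
    using v(2) by (simp add: eval_nat_numeral)
  also have "\<dots> \<le> exp v * u\<^sup>2"
    by simp
  also have "\<dots> \<le> exp \<bar>u\<bar> * u\<^sup>2"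
    using v(1) by (intro mult_right_mono) auto
  finally show ?thesis by (simp add: mult.commute)
qed

text \<open>An error bound in this form survives integration: a pointwise bound on the integrand
  passes directly to the integral.\<close>

lemma has_field_derivative_quadratic_bound:
  fixes F :: "real \<Rightarrow> real"
  assumes "d > 0" and bound: "\<And>y. \<bar>y - x\<bar> < d \<Longrightarrow> \<bar>F y - F x - D * (y - x)\<bar> \<le> C * (y - x)\<^sup>2"
  shows "(F has_field_derivative D) (at x)"
proof -
  have "((\<lambda>y. (F y - F x) / (y - x) - D) \<longlongrightarrow> 0) (at x)"
  proof (rule Lim_null_comparison)
    show "((\<lambda>y. C * \<bar>y - x\<bar>) \<longlongrightarrow> 0) (at x)"
      by (auto intro!: tendsto_eq_intros)
    have "\<bar>(F y - F x) / (y - x) - D\<bar> \<le> C * \<bar>y - x\<bar>" if "y \<noteq> x" "\<bar>y - x\<bar> < d" for y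
    proof -
      have "(F y - F x) / (y - x) - D = (F y - F x - D * (y - x)) / (y - x)"
        using that by (simp add: field_simps)
      then have "\<bar>(F y - F x) / (y - x) - D\<bar> = \<bar>F y - F x - D * (y - x)\<bar> / \<bar>y - x\<bar>"
        by (simp only: abs_divide)
      also have "\<dots> \<le> C * (y - x)\<^sup>2 / \<bar>y - x\<bar>"
        using bound[OF that(2)] by (intro divide_right_mono) auto
      also have "\<dots> = C * \<bar>y - x\<bar>"
        using that by (cases "y < x") (auto simp: field_simps power2_eq_square)
      finally show ?thesis .
    qed
    then show "\<forall>\<^sub>F y in at x. norm ((F y - F x) / (y - x) - D) \<le> C * \<bar>y - x\<bar>"
      using \<open>d > 0\<close> by (auto simp: eventually_at dist_real_def intro!: exI[of _ d])
  qed
  then show ?thesis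
    by (simp add: has_field_derivative_iff LIM_zero_iff)
qed

section \<open>Differentiation of the Laplace integral\<close>

lemma integrable_power_mult_exp_neg:
  fixes g :: "real \<Rightarrow> real"
  assumes g: "integrable lborel g" and supp: "\<And>t. t < 0 \<Longrightarrow> g t = 0" and "x > 0"
  shows "integrable lborel (\<lambda>t. (- t) ^ n * exp (- (x * t)) * g t)"
proof (rule Bochner_Integration.integrable_bound)
  show "integrable lborel (\<lambda>t. fact n / x ^ n * g t)"
    using g by simp
  show "AE t in lborel. norm ((- t) ^ n * exp (- (x * t)) * g t) \<le> norm (fact n / x ^ n * g t)"
  proof (rule AE_I2)
    fix t :: real
    show "norm ((- t) ^ n * exp (- (x * t)) * g t) \<le> norm (fact n / x ^ n * g t)"
      using mult_right_mono[OF power_mult_exp_neg_le[of x t n], of "\<bar>g t\<bar>"] \<open>x > 0\<close> supp[of t]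
      by (cases "t < 0") (auto simp: abs_mult power_abs)
  qed
qed (use borel_measurable_integrable[OF g] in measurable)

text \<open>The first-order Taylor error of the integrand in the parameter is at most
  \<open>(y - x)\<^sup>2\<close> times a fixed multiple of |g t|. Integrating this gives the
  quadratic bound for the integral.\<close>

lemma has_field_derivative_laplace_integral:
  fixes g :: "real \<Rightarrow> real"
  assumes g: "integrable lborel g" and supp: "\<And>t. t < 0 \<Longrightarrow> g t = 0" and "x > 0"
  shows "((\<lambda>x. LBINT t. (- t) ^ n * exp (- (x * t)) * g t) has_field_derivative
           (LBINT t. (- t) ^ Suc n * exp (- (x * t)) * g t)) (at x)"
proof -
  define e where "e n y t = (- t) ^ n * exp (- (y * t)) * g t" for n y t
  have int: "integrable lborel (e n y)" if "y > 0" for n y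
    unfolding e_def by (rule integrable_power_mult_exp_neg[OF g supp that])
  \<comment> \<open>One half of the decay rate \<open>x\<close> absorbs exp |h * t|, as |h| < x / 2
    for the increment \<open>h = y - x\<close>. The other half bounds \<open>t ^ (n + 2)\<close>,
    where \<open>n\<close> comes from the integrand and 2 from the Taylor remainder.\<close>
  define K where "K = fact (n + 2) / (x / 2) ^ (n + 2)"
  have pointwise: "\<bar>e n y t - e n x t - (y - x) * e (Suc n) x t\<bar> \<le> (y - x)\<^sup>2 * (K * \<bar>g t\<bar>)"
    if y: "\<bar>y - x\<bar> < x / 2" for y t
  proof (cases "t < 0")
    case False
    define h where "h = y - x"
    have y_eq: "y = x + h" by (simp add: h_def)
    have "e n y t - e n x t - h * e (Suc n) x t
        = (- t) ^ n * exp (- (x * t)) * g t * (exp (- (h * t)) - 1 - - (h * t))"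
      unfolding e_def y_eq by (simp add: algebra_simps exp_add[symmetric])
    then have "\<bar>e n y t - e n x t - h * e (Suc n) x t\<bar>
        = t ^ n * exp (- (x * t)) * \<bar>g t\<bar> * \<bar>exp (- (h * t)) - 1 - - (h * t)\<bar>"
      using False by (simp add: abs_mult power_abs)
    also have "\<dots> \<le> t ^ n * exp (- (x * t)) * \<bar>g t\<bar> * ((- (h * t))\<^sup>2 * exp \<bar>- (h * t)\<bar>)"
      using False by (intro mult_left_mono abs_exp_minus_linear_le) auto
    also have "t ^ n * exp (- (x * t)) * \<bar>g t\<bar> * ((- (h * t))\<^sup>2 * exp \<bar>- (h * t)\<bar>)
        \<le> t ^ n * exp (- (x * t)) * \<bar>g t\<bar> * ((- (h * t))\<^sup>2 * exp (x / 2 * t))"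
    proof -
      have "\<bar>- (h * t)\<bar> \<le> x / 2 * t"
        using mult_right_mono[of "\<bar>h\<bar>" "x / 2" t] False y by (simp add: h_def abs_mult)
      then show ?thesis
        using False by (intro mult_left_mono) auto
    qed
    also have "\<dots> = h\<^sup>2 * (t ^ (n + 2) * exp (- (x / 2 * t)) * \<bar>g t\<bar>)"
    proof -
      have "exp (- (x / 2 * t)) = exp (- (x * t)) * exp (x / 2 * t)"
        by (simp add: exp_add[symmetric])
      then show ?thesis by (simp add: power_add power_mult_distrib power2_eq_square)
    qed
    also have "\<dots> \<le> h\<^sup>2 * (K * \<bar>g t\<bar>)"
      unfolding K_def using False \<open>x > 0\<close>
      by (intro mult_left_mono mult_right_mono power_mult_exp_neg_le) auto
    finally show ?thesis by (simp add: h_def)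
  qed (simp add: e_def supp)
  have "((\<lambda>x. integral\<^sup>L lborel (e n x)) has_field_derivative integral\<^sup>L lborel (e (Suc n) x)) (at x)"
  proof (rule has_field_derivative_quadratic_bound)
    show "x / 2 > 0" using \<open>x > 0\<close> by simp
    fix y assume y: "\<bar>y - x\<bar> < x / 2"
    then have "y > 0" by linarith
    note int = int[OF \<open>y > 0\<close>] int[OF \<open>x > 0\<close>]
    have "integral\<^sup>L lborel (e n y) - integral\<^sup>L lborel (e n x)
          - integral\<^sup>L lborel (e (Suc n) x) * (y - x)
        = (LBINT t. e n y t - e n x t - (y - x) * e (Suc n) x t)"
      using int by simp
    also have "\<bar>\<dots>\<bar> \<le> (LBINT t. (y - x)\<^sup>2 * (K * \<bar>g t\<bar>))"
      using integral_abs_bound[of lborel "\<lambda>t. e n y t - e n x t - (y - x) * e (Suc n) x t"]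
      by (rule order_trans) (intro integral_mono pointwise[OF y];
          use int g in simp)
    also have "\<dots> = K * (LBINT t. \<bar>g t\<bar>) * (y - x)\<^sup>2"
      by simp
    finally show "\<bar>integral\<^sup>L lborel (e n y) - integral\<^sup>L lborel (e n x)
          - integral\<^sup>L lborel (e (Suc n) x) * (y - x)\<bar> \<le> K * (LBINT t. \<bar>g t\<bar>) * (y - x)\<^sup>2" .
  qed
  then show ?thesis unfolding e_def .
qed

lemma higher_deriv_laplace_integral:
  fixes g :: "real \<Rightarrow> real"
  assumes g: "integrable lborel g" and supp: "\<And>t. t < 0 \<Longrightarrow> g t = 0"
    and f: "\<And>x. x > 0 \<Longrightarrow> f x = (LBINT t. exp (- (x * t)) * g t)"
    and "x > 0"
  shows "(deriv ^^ n) f x = (LBINT t. (- t) ^ n * exp (- (x * t)) * g t)"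
  using \<open>x > 0\<close>
proof (induction n arbitrary: x)
  case 0
  then show ?case by (simp add: f)
next
  case (Suc n)
  \<comment> \<open>The induction hypothesis covers positive points only; this suffices because
    \<open>deriv\<close> at \<open>x\<close> depends only on values near \<open>x\<close>.\<close>
  have "\<forall>\<^sub>F y in nhds x. y \<in> {0<..}"
    using Suc.prems by (intro eventually_nhds_in_open) auto
  then have "\<forall>\<^sub>F y in nhds x. (deriv ^^ n) f y = (LBINT t. (- t) ^ n * exp (- (y * t)) * g t)"
    by eventually_elim (simp add: Suc.IH)
  then have "deriv ((deriv ^^ n) f) x = deriv (\<lambda>y. LBINT t. (- t) ^ n * exp (- (y * t)) * g t) x"
    by (rule deriv_cong_ev) simp
  also have "\<dots> = (LBINT t. (- t) ^ Suc n * exp (- (x * t)) * g t)"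
    by (intro DERIV_imp_deriv has_field_derivative_laplace_integral g supp Suc.prems)
  finally show ?case by simp
qed

section \<open>The kernel u exp(1 - u) and concentration of its powers\<close>

lemma mult_exp_one_minus_mono:
  fixes u v :: real
  assumes "0 \<le> u" "u \<le> v" "v \<le> 1"
  shows "u * exp (1 - u) \<le> v * exp (1 - v)"
proof (rule DERIV_nonneg_imp_nondecreasing[OF assms(2)])
  fix w assume w: "u \<le> w" "w \<le> v"
  have "((\<lambda>w. w * exp (1 - w)) has_real_derivative (1 - w) * exp (1 - w)) (at w)"
    by (auto intro!: derivative_eq_intros simp: algebra_simps)
  then show "\<exists>y. ((\<lambda>w. w * exp (1 - w)) has_real_derivative y) (at w) \<and> 0 \<le> y"
    using w assms by (intro exI[of _ "(1 - w) * exp (1 - w)"] conjI) auto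
qed

lemma mult_exp_one_minus_antimono:
  fixes u v :: real
  assumes "1 \<le> u" "u \<le> v"
  shows "v * exp (1 - v) \<le> u * exp (1 - u)"
proof (rule DERIV_nonpos_imp_nonincreasing[OF assms(2)])
  fix w assume w: "u \<le> w" "w \<le> v"
  have "((\<lambda>w. w * exp (1 - w)) has_real_derivative (1 - w) * exp (1 - w)) (at w)"
    by (auto intro!: derivative_eq_intros simp: algebra_simps)
  then show "\<exists>y. ((\<lambda>w. w * exp (1 - w)) has_real_derivative y) (at w) \<and> y \<le> 0"
    using w assms by (intro exI[of _ "(1 - w) * exp (1 - w)"] conjI) (auto intro: mult_nonpos_nonneg)
qed

text \<open>This is the strict inequality 1 + v < exp v for v = u - 1, multiplied by exp(1 -
  u).\<close>

lemma mult_exp_one_minus_less_one: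
  fixes u :: real
  assumes "u \<noteq> 1"
  shows "u * exp (1 - u) < 1"
proof -
  have "u < exp (u - 1)"
    using exp_minus_greater[of "1 - u"] assms by simp
  then have "u * exp (1 - u) < exp (u - 1) * exp (1 - u)"
    by simp
  then show ?thesis by (simp add: exp_add[symmetric])
qed

text \<open>The kernel rises up to 1 and falls afterwards, so its values outside the window are
  bounded by the larger of the two at the edges 1 - d and 1 + d.\<close>

lemma mult_exp_one_minus_gap:
  fixes d :: real
  assumes "0 < d" "d < 1"
  obtains q where "0 < q" "q < 1"
    "\<And>u. 0 \<le> u \<Longrightarrow> \<bar>u - 1\<bar> \<ge> d \<Longrightarrow> u * exp (1 - u) \<le> q"
proof
  let ?k = "\<lambda>u::real. u * exp (1 - u)"
  show "0 < max (?k (1 - d)) (?k (1 + d))"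
    using assms by (simp add: less_max_iff_disj)
  show "max (?k (1 - d)) (?k (1 + d)) < 1"
    using assms mult_exp_one_minus_less_one[of "1 - d"] mult_exp_one_minus_less_one[of "1 + d"]
    by simp
  fix u :: real assume u: "0 \<le> u" "\<bar>u - 1\<bar> \<ge> d"
  then consider "u \<le> 1 - d" | "1 + d \<le> u" by linarith
  then show "?k u \<le> max (?k (1 - d)) (?k (1 + d))"
  proof cases
    case 1
    then show ?thesis
      using mult_exp_one_minus_mono[of u "1 - d"] u assms by (intro max.coboundedI1) auto
  next
    case 2
    then show ?thesis
      using mult_exp_one_minus_antimono[of "1 + d" u] assms by (intro max.coboundedI2) auto
  qed
qed

text \<open>If \<open>g s < 0\<close>, the rescaled kernel is at most \<open>q\<close> far from
  \<open>s\<close> and at least \<open>r > q\<close> on a small interval around \<open>s\<close>.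
  Its \<open>n\<close>-th power then gives an integral of at most \<open>q ^ n\<close> times the L1
  norm of \<open>g\<close>, minus a positive multiple of \<open>r ^ n\<close>, which is negative for
  large \<open>n\<close>.\<close>

lemma nonneg_if_power_kernel_integrals_nonneg:
  fixes g :: "real \<Rightarrow> real"
  assumes g: "integrable lborel g" and supp: "\<And>t. t < 0 \<Longrightarrow> g t = 0"
    and "s > 0" and cont: "isCont g s"
    and nonneg: "\<And>n x. x > 0 \<Longrightarrow> (LBINT t. t ^ n * exp (- (x * t)) * g t) \<ge> 0"
  shows "g s \<ge> 0"
proof (rule ccontr)
  assume "\<not> g s \<ge> 0"
  define c where "c = - g s / 2"
  have "c > 0" using \<open>\<not> g s \<ge> 0\<close> by (simp add: c_def)
  define k where "k t = t / s * exp (1 - t / s)" for t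
  obtain d0 where "d0 > 0" and d0: "\<And>t. \<bar>t - s\<bar> < d0 \<Longrightarrow> \<bar>g t - g s\<bar> < c"
    using cont[unfolded continuous_at_eps_delta, rule_format, OF \<open>c > 0\<close>]
    by (auto simp: dist_real_def)
  \<comment> \<open>A relative radius: |t - s| < d * s means |t / s - 1| < d. The first bound keeps
    the window where \<open>g \<le> - c\<close>, the second ensures \<open>d < 1\<close>.\<close>
  define d where "d = min (d0 / s) (1 / 2)"
  have d: "0 < d" "d < 1" "d * s \<le> d0"
    using \<open>d0 > 0\<close> \<open>s > 0\<close> by (auto simp: d_def min_def field_simps)
  obtain q where q: "0 < q" "q < 1"
    and far: "\<And>u. 0 \<le> u \<Longrightarrow> \<bar>u - 1\<bar> \<ge> d \<Longrightarrow> u * exp (1 - u) \<le> q"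
    using mult_exp_one_minus_gap[OF d(1,2)] by blast
  \<comment> \<open>Any number strictly between \<open>q\<close> and 1 would do: since
    \<open>k s = 1\<close>, continuity makes \<open>k\<close> exceed it near
    \<open>s\<close>.\<close>
  define r where "r = (1 + q) / 2"
  have r: "q < r" "r < 1" using q by (auto simp: r_def)
  have "isCont k s"
    unfolding k_def using \<open>s > 0\<close> by (intro continuous_intros) auto
  moreover have "k s = 1" using \<open>s > 0\<close> by (simp add: k_def)
  moreover have "1 - r > 0" using r by simp
  ultimately obtain e0 where "e0 > 0" and e0: "\<And>t. \<bar>t - s\<bar> < e0 \<Longrightarrow> \<bar>k t - 1\<bar> < 1 - r"
    unfolding continuous_at_eps_delta dist_real_def by metis
  \<comment> \<open>The halves make the inequalities strict, so that the closed interval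
    \<open>I\<close> lies among positive points where both \<open>k t > r\<close> and
    \<open>g t \<le> - c\<close>.\<close>
  define e where "e = min (e0 / 2) (min (d * s) s / 2)"
  have e: "0 < e" "e < e0" "e < d * s" "e < s"
    using \<open>e0 > 0\<close> \<open>s > 0\<close> d(1) by (auto simp: e_def min_less_iff_disj)
  define I where "I = {s - e..s + e}"
  \<comment> \<open>Far from \<open>s\<close> the indicator vanishes and \<open>k t \<le> q\<close>.
    Within the window \<open>g\<close> is negative, so points outside \<open>I\<close> contribute at
    most 0 and points of \<open>I\<close> at most \<open>- c * r ^ n\<close>.\<close>
  have pointwise: "k t ^ n * g t \<le> q ^ n * \<bar>g t\<bar> - c * r ^ n * indicator I t" for n t
  proof -
    consider "t < 0" | "t \<ge> 0" "\<bar>t - s\<bar> \<ge> d * s" | "t \<ge> 0" "\<bar>t - s\<bar> < d * s" by linarith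
    then show ?thesis
    proof cases
      case 1
      then have "t \<notin> I" using e by (auto simp: I_def)
      then show ?thesis using 1 by (simp add: supp)
    next
      case 2
      then have "t \<notin> I" using e by (auto simp: I_def)
      have "t / s - 1 = (t - s) / s"
        using \<open>s > 0\<close> by (simp add: field_simps)
      then have "\<bar>t / s - 1\<bar> \<ge> d"
        using 2 \<open>s > 0\<close> by (simp add: abs_divide pos_le_divide_eq)
      then have "k t \<le> q"
        unfolding k_def using 2 \<open>s > 0\<close> by (intro far) auto
      moreover have "k t \<ge> 0" using 2 \<open>s > 0\<close> by (simp add: k_def)
      ultimately have "k t ^ n * \<bar>g t\<bar> \<le> q ^ n * \<bar>g t\<bar>"
        by (intro mult_right_mono power_mono) auto
      moreover have "k t ^ n * g t \<le> k t ^ n * \<bar>g t\<bar>"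
        using \<open>k t \<ge> 0\<close> by (intro mult_left_mono) auto
      ultimately show ?thesis using \<open>t \<notin> I\<close> by simp
    next
      case 3
      then have gt: "g t \<le> - c"
        using d0[of t] d(3) unfolding c_def by linarith
      have "k t \<ge> 0" using 3 \<open>s > 0\<close> by (simp add: k_def)
      have "q ^ n * \<bar>g t\<bar> \<ge> 0" using q by simp
      moreover have "k t ^ n * g t \<le> - (c * r ^ n * indicator I t)"
      proof (cases "t \<in> I")
        case True
        then have "\<bar>t - s\<bar> < e0" using e by (auto simp: I_def)
        then have "r ^ n \<le> k t ^ n"
          using e0[of t] r q by (intro power_mono) auto
        then have "r ^ n * c \<le> k t ^ n * (- g t)"
          using gt \<open>c > 0\<close> \<open>k t \<ge> 0\<close> by (intro mult_mono) auto
        then show ?thesis using True by (simp add: mult.commute)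
      next
        case False
        then show ?thesis
          using \<open>k t \<ge> 0\<close> gt \<open>c > 0\<close> by (simp add: mult_nonneg_nonpos)
      qed
      ultimately show ?thesis by linarith
    qed
  qed
  \<comment> \<open>The restriction \<open>n > 0\<close> makes the Laplace parameter
    \<open>n / s\<close> positive; \<open>2 * e\<close> is the length of \<open>I\<close>.\<close>
  have main: "c * r ^ n * (2 * e) \<le> q ^ n * (LBINT t. \<bar>g t\<bar>)" if "n > 0" for n
  proof -
    define A where "A = (exp 1 / s) ^ n"
    have k_pow: "k t ^ n * g t = A * (t ^ n * exp (- (n / s * t)) * g t)" for t
    proof -
      have "exp (1 - t / s) ^ n = exp (real n - n / s * t)"
        by (simp add: exp_of_nat_mult[symmetric] algebra_simps)
      also have "\<dots> = exp 1 ^ n * exp (- (n / s * t))"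
        by (simp add: exp_of_nat_mult[symmetric] exp_add[symmetric])
      finally show ?thesis
        by (simp add: k_def A_def power_mult_distrib power_divide)
    qed
    have "integrable lborel (\<lambda>t. (- 1) ^ n * ((- t) ^ n * exp (- (n / s * t)) * g t))"
      using integrable_power_mult_exp_neg[OF g supp, of "n / s" n] \<open>s > 0\<close> that by simp
    then have "integrable lborel (\<lambda>t. t ^ n * exp (- (n / s * t)) * g t)"
      by (simp add: mult.assoc[symmetric] power_mult_distrib[symmetric])
    then have int: "integrable lborel (\<lambda>t. k t ^ n * g t)"
      unfolding k_pow by simp
    have intI: "integrable lborel (indicator I :: real \<Rightarrow> real)"
      unfolding I_def by (intro integrable_real_indicator) (auto simp: emeasure_lborel_Icc_eq)
    have "0 \<le> A * (LBINT t. t ^ n * exp (- (n / s * t)) * g t)"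
      using nonneg[of "n / s" n] \<open>s > 0\<close> that by (simp add: A_def)
    also have "\<dots> = (LBINT t. k t ^ n * g t)"
      unfolding k_pow by simp
    also have "\<dots> \<le> (LBINT t. q ^ n * \<bar>g t\<bar> - c * r ^ n * indicator I t)"
      using int intI g by (intro integral_mono pointwise) auto
    also have "\<dots> = q ^ n * (LBINT t. \<bar>g t\<bar>) - c * r ^ n * (2 * e)"
      using intI g e by (simp add: I_def)
    finally show ?thesis by simp
  qed
  \<comment> \<open>Dividing the estimate by \<open>r ^ n\<close> leaves a fixed positive number
    below a null sequence.\<close>
  have "(\<lambda>n. (q / r) ^ n * (LBINT t. \<bar>g t\<bar>)) \<longlonglongrightarrow> 0 * (LBINT t. \<bar>g t\<bar>)"
    using q r by (intro tendsto_intros LIMSEQ_power_zero) auto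
  moreover have "\<forall>\<^sub>F n in sequentially. c * (2 * e) \<le> (q / r) ^ n * (LBINT t. \<bar>g t\<bar>)"
    using eventually_gt_at_top[of 0]
  proof eventually_elim
    case (elim n)
    then show ?case using main[of n] q r by (simp add: power_divide field_simps)
  qed
  ultimately have "c * (2 * e) \<le> 0"
    using tendsto_lowerbound by fastforce
  then show False using \<open>c > 0\<close> e by (simp add: mult_le_0_iff)
qed

section \<open>Application to completely monotonic Laplace transforms\<close>

theorem proposition2p2:
  fixes \<phi> f :: "real \<Rightarrow> real"
  assumes "continuous_on {0..} \<phi>"
    and "set_integrable lborel {0..} (\<lambda>t. \<bar>\<phi> t\<bar>)"
    and "\<And>x. x > 0 \<Longrightarrow> f x = (LBINT t:{0..}. \<phi> t * exp (- (x * t)))"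
    and "completely_monotonic f"
  shows "\<forall>t\<in>{0..}. \<phi> t \<ge> 0"
proof -
  define g where "g t = indicator {0..} t * \<phi> t" for t :: real
  have supp: "g t = 0" if "t < 0" for t
    using that by (simp add: g_def)
  \<comment> \<open>Integrability of |g| does not by itself make \<open>g\<close> measurable; this
    comes from the continuity of \<open>\<phi>\<close>.\<close>
  have "g \<in> borel_measurable lborel"
    using borel_measurable_continuous_on_indicator[OF _ assms(1)]
    by (simp add: g_def[abs_def])
  moreover have "integrable lborel (\<lambda>t. \<bar>g t\<bar>)"
    using assms(2) by (simp add: set_integrable_def g_def abs_mult)
  ultimately have g: "integrable lborel g"
    by (simp add: integrable_abs_iff)
  have f: "f x = (LBINT t. exp (- (x * t)) * g t)" if "x > 0" for x
    unfolding assms(3)[OF that] set_lebesgue_integral_def g_def by (simp add: mult_ac)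
  have nonneg: "(LBINT t. t ^ n * exp (- (x * t)) * g t) \<ge> 0" if "x > 0" for n x
  proof -
    \<comment> \<open>The alternating sign cancels the one in \<open>(- t) ^ n\<close>.\<close>
    have "0 \<le> (- 1) ^ n * (deriv ^^ n) f x"
      using assms(4) that by (auto simp: completely_monotonic_def)
    also have "\<dots> = (LBINT t. (- 1) ^ n * ((- t) ^ n * exp (- (x * t)) * g t))"
      by (simp add: higher_deriv_laplace_integral[OF g supp f that])
    also have "\<dots> = (LBINT t. t ^ n * exp (- (x * t)) * g t)"
      by (simp add: mult.assoc[symmetric] power_mult_distrib[symmetric])
    finally show ?thesis .
  qed
  have pos: "\<phi> s \<ge> 0" if "s > 0" for s
  proof -
    \<comment> \<open>The extension by zero may jump at 0, but it agrees with \<open>\<phi>\<close>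
      near every positive \<open>s\<close>.\<close>
    have "isCont \<phi> s"
      using assms(1) that by (intro continuous_on_interior[of "{0..}"]) auto
    moreover have "\<forall>\<^sub>F t in nhds s. t \<in> {0<..}"
      using that by (intro eventually_nhds_in_open) auto
    then have "\<forall>\<^sub>F t in nhds s. g t = \<phi> t"
      by eventually_elim (simp add: g_def)
    ultimately have "isCont g s"
      by (simp add: isCont_cong)
    then have "g s \<ge> 0"
      using nonneg_if_power_kernel_integrals_nonneg[OF g supp that _ nonneg] by blast
    then show ?thesis using that by (simp add: g_def)
  qed
  \<comment> \<open>The endpoint 0 is reached by continuity of \<open>\<phi>\<close> on the
    closure.\<close>
  have "closure {0<..} = {0::real..}" by simp
  then show ?thesis
    using continuous_ge_on_closure[of "{0<..}" \<phi> _ 0] assms(1) pos by auto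
qed

end
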